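(* Let $\mathbb{A}$ be a symmetric strict monoidal category and let $\mathbf{H}\,\mathcal{C}(\mathbb{A})$ be the strict monoidal category of horizontal cells of its free cornering. There is a contravariant involution $(-)^*:\mathbf{H}\,\mathcal{C}(\mathbb{A})^{\mathsf{op}}\to\mathbf{H}\,\mathcal{C}(\mathbb{A})$ (a functor with $X^{**}=X$ and $f^{**}=f$ for all objects $X$ and morphisms $f$), given on objects by $I^*=I$, $(A^\circ)^*=A^\bullet$, $(A^\bullet)^*=A^\circ$ and $(X\otimes Y)^*=X^*\otimes Y^*$, with the property that $(f\otimes g)^*=f^*\otimes g^*$ for all morphisms $f,g$.
   Context: Single-object double categories. A single-object double category $\mathbb{D}$ consists of a monoid $(\mathbb{D}_H,\otimes,I)$ of horizontal edges, a monoid $(\mathbb{D}_V,\otimes,I)$ of vertical edges, and cells $\alpha$, each with a top and a bottom boundary in $\mathbb{D}_H$ and a left and a right boundary in $\mathbb{D}_V$. If the right boundary of $\alpha$ equals the left boundary of $\beta$ there is a horizontal composite $\alpha\vert\beta$ (top/bottom boundaries are multiplied in the order $\alpha,\beta$; left boundary that of $\alpha$, right boundary that of $\beta$). If the bottom boundary of $\alpha$ equals the top boundary of $\beta$ there is a vertical composite $\frac{\alpha}{\beta}$ (left/right boundaries multiplied in the order $\alpha,\beta$; top that of $\alpha$, bottom that of $\beta$). Both compositions are associative and unital, with identity cells $1_A$ for $A\in\mathbb{D}_H$ (top $=$ bottom $=A$, left $=$ right $=I$; identities for vertical composition) and $1_X$ for $X\in\mathbb{D}_V$ (left $=$ right $=X$,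 top $=$ bottom $=I$; identities for horizontal composition), with $1_A\vert 1_B=1_{A\otimes B}$, $\frac{1_X}{1_Y}=1_{X\otimes Y}$, the two identity cells on $I$ coincide, and the interchange law $\frac{\alpha}{\beta}\big\vert\frac{\gamma}{\delta}=\frac{\alpha\vert\gamma}{\beta\vert\delta}$ holds. Horizontal cells. $\mathbf{H}\mathbb{D}$ is the strict monoidal category with object set $\mathbb{D}_V$, whose morphisms $X\to Y$ are cells with left boundary $X$, right boundary $Y$ and top and bottom boundary $I$; composition is horizontal composition, and the tensor product is vertical composition, $h\otimes k=\frac{h}{k}$. Free cornering. For a symmetric strict monoidal category $\mathbb{A}$ (with object set $\mathbb{A}_0$), $\mathcal{C}(\mathbb{A})$ is the free single-object double category determined by: horizontal edge monoid $(\mathbb{A}_0,\otimes,I)$; vertical edge monoid the free monoid $\mathbb{A}^{\circ\bullet}=(\mathbb{A}_0\times\{\circ,\bullet\})^*$, with generators written $A^\circ$, $A^\bullet$, product written $\otimes$ and unit $I$; generating cells, for each $A\in\mathbb{A}_0$, the corners (boundaries not mentioned are $I$) - $s^\circ_A$: top $A$, right $A^\circ$; $\quad r^\circ_A$: left $A^\circ$, bottom $A$; - $s^\bullet_A$: top $A$, left $A^\bullet$; $\quad r^\bullet_A$: right $A^\bullet$, bottom $A$; and, for each morphism $f:A\to B$ of $\mathbb{A}$, a cell $\ulcorner f\urcorner$ with top $A$, bottom $B$; subject to the yanking equations $s^\circ_A\vert r^\circ_A=1_A$, $\frac{r^\circ_A}{s^\circ_A}=1_{A^\circ}$, $r^\bullet_A\vert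 s^\bullet_A=1_A$, $\frac{r^\bullet_A}{s^\bullet_A}=1_{A^\bullet}$, and the equations $\frac{\ulcorner f\urcorner}{\ulcorner g\urcorner}=\ulcorner f;g\urcorner$ (for composable $f,g$; $f;g$ is "first $f$ then $g$"), $\ulcorner 1_A\urcorner=1_A$, $\ulcorner f\urcorner\vert\ulcorner g\urcorner=\ulcorner f\otimes g\urcorner$. *)

theory Defs
  imports "HOL-Algebra.Group"
begin

section \<open>Symmetric strict monoidal categories\<close>

text \<open>Composition is written in diagrammatic order: \<open>Comp C f g\<close> is first \<open>f\<close>, then \<open>g\<close>.
  The operations are only meaningful on \<open>Ob C\<close> and \<open>Arr C\<close>.\<close>

record ('o, 'a) category_data =
  Ob :: "'o set"
  Arr :: "'a set"
  Dom :: "'a \<Rightarrow> 'o"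
  Cod :: "'a \<Rightarrow> 'o"
  Ident :: "'o \<Rightarrow> 'a"
  Comp :: "'a \<Rightarrow> 'a \<Rightarrow> 'a"

record ('o, 'a) monoidal_data = "('o, 'a) category_data" +
  TUnit :: 'o
  TOb :: "'o \<Rightarrow> 'o \<Rightarrow> 'o"
  TArr :: "'a \<Rightarrow> 'a \<Rightarrow> 'a"

record ('o, 'a) symmetric_monoidal_data = "('o, 'a) monoidal_data" +
  Sym :: "'o \<Rightarrow> 'o \<Rightarrow> 'a"

locale category =
  fixes C :: "('o, 'a, 'x) category_data_scheme"
  assumes Dom_closed: "f \<in> Arr C \<Longrightarrow> Dom C f \<in> Ob C"
    and Cod_closed: "f \<in> Arr C \<Longrightarrow> Cod C f \<in> Ob C"
    and Ident_closed: "X \<in> Ob C \<Longrightarrow> Ident C X \<in> Arr C"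
    and Dom_Ident: "X \<in> Ob C \<Longrightarrow> Dom C (Ident C X) = X"
    and Cod_Ident: "X \<in> Ob C \<Longrightarrow> Cod C (Ident C X) = X"
    and Comp_closed: "\<lbrakk>f \<in> Arr C; g \<in> Arr C; Cod C f = Dom C g\<rbrakk> \<Longrightarrow> Comp C f g \<in> Arr C"
    and Dom_Comp: "\<lbrakk>f \<in> Arr C; g \<in> Arr C; Cod C f = Dom C g\<rbrakk> \<Longrightarrow> Dom C (Comp C f g) = Dom C f"
    and Cod_Comp: "\<lbrakk>f \<in> Arr C; g \<in> Arr C; Cod C f = Dom C g\<rbrakk> \<Longrightarrow> Cod C (Comp C f g) = Cod C g"
    and Comp_Ident_left: "f \<in> Arr C \<Longrightarrow> Comp C (Ident C (Dom C f)) f = f"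
    and Comp_Ident_right: "f \<in> Arr C \<Longrightarrow> Comp C f (Ident C (Cod C f)) = f"
    and Comp_assoc: "\<lbrakk>f \<in> Arr C; g \<in> Arr C; h \<in> Arr C; Cod C f = Dom C g; Cod C g = Dom C h\<rbrakk>
          \<Longrightarrow> Comp C (Comp C f g) h = Comp C f (Comp C g h)"

definition object_monoid :: "('o, 'a, 'x) monoidal_data_scheme \<Rightarrow> 'o monoid" where
  "object_monoid C = \<lparr>carrier = Ob C, monoid.mult = TOb C, one = TUnit C\<rparr>"

locale strict_monoidal_category = category C
  for C :: "('o, 'a, 'x) monoidal_data_scheme" +
  assumes object_monoid: "Group.monoid (object_monoid C)"
    and TArr_closed: "\<lbrakk>f \<in> Arr C; g \<in> Arr C\<rbrakk> \<Longrightarrow> TArr C f g \<in> Arr C"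
    and Dom_TArr: "\<lbrakk>f \<in> Arr C; g \<in> Arr C\<rbrakk> \<Longrightarrow> Dom C (TArr C f g) = TOb C (Dom C f) (Dom C g)"
    and Cod_TArr: "\<lbrakk>f \<in> Arr C; g \<in> Arr C\<rbrakk> \<Longrightarrow> Cod C (TArr C f g) = TOb C (Cod C f) (Cod C g)"
    and TArr_Ident: "\<lbrakk>X \<in> Ob C; Y \<in> Ob C\<rbrakk>
          \<Longrightarrow> TArr C (Ident C X) (Ident C Y) = Ident C (TOb C X Y)"
    and TArr_Comp: "\<lbrakk>f \<in> Arr C; g \<in> Arr C; h \<in> Arr C; k \<in> Arr C;
            Cod C f = Dom C g; Cod C h = Dom C k\<rbrakk>
          \<Longrightarrow> TArr C (Comp C f g) (Comp C h k) = Comp C (TArr C f h) (TArr C g k)"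
    and TArr_assoc: "\<lbrakk>f \<in> Arr C; g \<in> Arr C; h \<in> Arr C\<rbrakk>
          \<Longrightarrow> TArr C (TArr C f g) h = TArr C f (TArr C g h)"
    and TArr_unit_left: "f \<in> Arr C \<Longrightarrow> TArr C (Ident C (TUnit C)) f = f"
    and TArr_unit_right: "f \<in> Arr C \<Longrightarrow> TArr C f (Ident C (TUnit C)) = f"

text \<open>The other hexagon and the unit coherence of the symmetry follow from the axioms below.\<close>

locale symmetric_strict_monoidal_category = strict_monoidal_category C
  for C :: "('o, 'a, 'x) symmetric_monoidal_data_scheme" +
  assumes Sym_closed: "\<lbrakk>X \<in> Ob C; Y \<in> Ob C\<rbrakk> \<Longrightarrow> Sym C X Y \<in> Arr C"
    and Dom_Sym: "\<lbrakk>X \<in> Ob C; Y \<in> Ob C\<rbrakk> \<Longrightarrow> Dom C (Sym C X Y) = TOb C X Y"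
    and Cod_Sym: "\<lbrakk>X \<in> Ob C; Y \<in> Ob C\<rbrakk> \<Longrightarrow> Cod C (Sym C X Y) = TOb C Y X"
    and Sym_natural: "\<lbrakk>f \<in> Arr C; g \<in> Arr C\<rbrakk>
          \<Longrightarrow> Comp C (TArr C f g) (Sym C (Cod C f) (Cod C g))
            = Comp C (Sym C (Dom C f) (Dom C g)) (TArr C g f)"
    and Sym_involutive: "\<lbrakk>X \<in> Ob C; Y \<in> Ob C\<rbrakk>
          \<Longrightarrow> Comp C (Sym C X Y) (Sym C Y X) = Ident C (TOb C X Y)"
    and Sym_hexagon: "\<lbrakk>X \<in> Ob C; Y \<in> Ob C; Z \<in> Ob C\<rbrakk>
          \<Longrightarrow> Sym C X (TOb C Y Z)
            = Comp C (TArr C (Sym C X Y) (Ident C Z)) (TArr C (Ident C Y) (Sym C X Z))"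

definition opposite :: "('o, 'a, 'x) category_data_scheme \<Rightarrow> ('o, 'a, 'x) category_data_scheme" where
  "opposite C = C\<lparr>Dom := Cod C, Cod := Dom C, Comp := (\<lambda>f g. Comp C g f)\<rparr>"

locale category_functor = source: category C + target: category D
  for C :: "('o, 'a, 'x) category_data_scheme"
    and D :: "('p, 'b, 'y) category_data_scheme" +
  fixes Fo :: "'o \<Rightarrow> 'p" and Fa :: "'a \<Rightarrow> 'b"
  assumes Fo_closed: "X \<in> Ob C \<Longrightarrow> Fo X \<in> Ob D"
    and Fa_closed: "f \<in> Arr C \<Longrightarrow> Fa f \<in> Arr D"
    and Dom_Fa: "f \<in> Arr C \<Longrightarrow> Dom D (Fa f) = Fo (Dom C f)"
    and Cod_Fa: "f \<in> Arr C \<Longrightarrow> Cod D (Fa f) = Fo (Cod C f)"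
    and Fa_Ident: "X \<in> Ob C \<Longrightarrow> Fa (Ident C X) = Ident D (Fo X)"
    and Fa_Comp: "\<lbrakk>f \<in> Arr C; g \<in> Arr C; Cod C f = Dom C g\<rbrakk>
          \<Longrightarrow> Fa (Comp C f g) = Comp D (Fa f) (Fa g)"

definition contravariant_involution ::
    "('o, 'a, 'x) category_data_scheme \<Rightarrow> ('o \<Rightarrow> 'o) \<Rightarrow> ('a \<Rightarrow> 'a) \<Rightarrow> bool" where
  "contravariant_involution C So Sa \<longleftrightarrow>
     category_functor (opposite C) C So Sa \<and>
     (\<forall>X\<in>Ob C. So (So X) = X) \<and> (\<forall>f\<in>Arr C. Sa (Sa f) = f)"


section \<open>Single-object double categories\<close>

record ('h, 'v, 'c) double_category_data =
  HEdges :: "'h monoid"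
  VEdges :: "'v monoid"
  Cells :: "'c set"
  Top_edge :: "'c \<Rightarrow> 'h"
  Bottom_edge :: "'c \<Rightarrow> 'h"
  Left_edge :: "'c \<Rightarrow> 'v"
  Right_edge :: "'c \<Rightarrow> 'v"
  HEdge_id :: "'h \<Rightarrow> 'c"
  VEdge_id :: "'v \<Rightarrow> 'c"
  hcomp :: "'c \<Rightarrow> 'c \<Rightarrow> 'c"
  vcomp :: "'c \<Rightarrow> 'c \<Rightarrow> 'c"

locale single_object_double_category =
  fixes D :: "('h, 'v, 'c, 'x) double_category_data_scheme"
  assumes HEdges_monoid: "Group.monoid (HEdges D)"
    and VEdges_monoid: "Group.monoid (VEdges D)"
    and boundary_closed: "\<alpha> \<in> Cells D \<Longrightarrow>
          Top_edge D \<alpha> \<in> carrier (HEdges D) \<and> Bottom_edge D \<alpha> \<in> carrier (HEdges D) \<and>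
          Left_edge D \<alpha> \<in> carrier (VEdges D) \<and> Right_edge D \<alpha> \<in> carrier (VEdges D)"
    and HEdge_id: "A \<in> carrier (HEdges D) \<Longrightarrow> HEdge_id D A \<in> Cells D \<and>
          Top_edge D (HEdge_id D A) = A \<and> Bottom_edge D (HEdge_id D A) = A \<and>
          Left_edge D (HEdge_id D A) = \<one>\<^bsub>VEdges D\<^esub> \<and> Right_edge D (HEdge_id D A) = \<one>\<^bsub>VEdges D\<^esub>"
    and VEdge_id: "X \<in> carrier (VEdges D) \<Longrightarrow> VEdge_id D X \<in> Cells D \<and>
          Top_edge D (VEdge_id D X) = \<one>\<^bsub>HEdges D\<^esub> \<and> Bottom_edge D (VEdge_id D X) = \<one>\<^bsub>HEdges D\<^esub> \<and>
          Left_edge D (VEdge_id D X) = X \<and> Right_edge D (VEdge_id D X) = X"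
    and hcomp: "\<lbrakk>\<alpha> \<in> Cells D; \<beta> \<in> Cells D; Right_edge D \<alpha> = Left_edge D \<beta>\<rbrakk> \<Longrightarrow> hcomp D \<alpha> \<beta> \<in> Cells D \<and>
          Top_edge D (hcomp D \<alpha> \<beta>) = Top_edge D \<alpha> \<otimes>\<^bsub>HEdges D\<^esub> Top_edge D \<beta> \<and>
          Bottom_edge D (hcomp D \<alpha> \<beta>) = Bottom_edge D \<alpha> \<otimes>\<^bsub>HEdges D\<^esub> Bottom_edge D \<beta> \<and>
          Left_edge D (hcomp D \<alpha> \<beta>) = Left_edge D \<alpha> \<and> Right_edge D (hcomp D \<alpha> \<beta>) = Right_edge D \<beta>"
    and vcomp: "\<lbrakk>\<alpha> \<in> Cells D; \<beta> \<in> Cells D; Bottom_edge D \<alpha> = Top_edge D \<beta>\<rbrakk> \<Longrightarrow> vcomp D \<alpha> \<beta> \<in> Cells D \<and>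
          Top_edge D (vcomp D \<alpha> \<beta>) = Top_edge D \<alpha> \<and> Bottom_edge D (vcomp D \<alpha> \<beta>) = Bottom_edge D \<beta> \<and>
          Left_edge D (vcomp D \<alpha> \<beta>) = Left_edge D \<alpha> \<otimes>\<^bsub>VEdges D\<^esub> Left_edge D \<beta> \<and>
          Right_edge D (vcomp D \<alpha> \<beta>) = Right_edge D \<alpha> \<otimes>\<^bsub>VEdges D\<^esub> Right_edge D \<beta>"
    and hcomp_assoc: "\<lbrakk>\<alpha> \<in> Cells D; \<beta> \<in> Cells D; \<gamma> \<in> Cells D;
            Right_edge D \<alpha> = Left_edge D \<beta>; Right_edge D \<beta> = Left_edge D \<gamma>\<rbrakk>
          \<Longrightarrow> hcomp D (hcomp D \<alpha> \<beta>) \<gamma> = hcomp D \<alpha> (hcomp D \<beta> \<gamma>)"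
    and hcomp_unit_left: "\<alpha> \<in> Cells D \<Longrightarrow> hcomp D (VEdge_id D (Left_edge D \<alpha>)) \<alpha> = \<alpha>"
    and hcomp_unit_right: "\<alpha> \<in> Cells D \<Longrightarrow> hcomp D \<alpha> (VEdge_id D (Right_edge D \<alpha>)) = \<alpha>"
    and vcomp_assoc: "\<lbrakk>\<alpha> \<in> Cells D; \<beta> \<in> Cells D; \<gamma> \<in> Cells D;
            Bottom_edge D \<alpha> = Top_edge D \<beta>; Bottom_edge D \<beta> = Top_edge D \<gamma>\<rbrakk>
          \<Longrightarrow> vcomp D (vcomp D \<alpha> \<beta>) \<gamma> = vcomp D \<alpha> (vcomp D \<beta> \<gamma>)"
    and vcomp_unit_top: "\<alpha> \<in> Cells D \<Longrightarrow> vcomp D (HEdge_id D (Top_edge D \<alpha>)) \<alpha> = \<alpha>"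
    and vcomp_unit_bottom: "\<alpha> \<in> Cells D \<Longrightarrow> vcomp D \<alpha> (HEdge_id D (Bottom_edge D \<alpha>)) = \<alpha>"
    and HEdge_id_mult: "\<lbrakk>A \<in> carrier (HEdges D); B \<in> carrier (HEdges D)\<rbrakk>
          \<Longrightarrow> hcomp D (HEdge_id D A) (HEdge_id D B) = HEdge_id D (A \<otimes>\<^bsub>HEdges D\<^esub> B)"
    and VEdge_id_mult: "\<lbrakk>X \<in> carrier (VEdges D); Y \<in> carrier (VEdges D)\<rbrakk>
          \<Longrightarrow> vcomp D (VEdge_id D X) (VEdge_id D Y) = VEdge_id D (X \<otimes>\<^bsub>VEdges D\<^esub> Y)"
    and unit_ids_coincide: "HEdge_id D \<one>\<^bsub>HEdges D\<^esub> = VEdge_id D \<one>\<^bsub>VEdges D\<^esub>"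
    and interchange: "\<lbrakk>\<alpha> \<in> Cells D; \<beta> \<in> Cells D; \<gamma> \<in> Cells D; \<delta> \<in> Cells D;
            Bottom_edge D \<alpha> = Top_edge D \<beta>; Bottom_edge D \<gamma> = Top_edge D \<delta>;
            Right_edge D \<alpha> = Left_edge D \<gamma>; Right_edge D \<beta> = Left_edge D \<delta>\<rbrakk>
          \<Longrightarrow> hcomp D (vcomp D \<alpha> \<beta>) (vcomp D \<gamma> \<delta>) = vcomp D (hcomp D \<alpha> \<gamma>) (hcomp D \<beta> \<delta>)"

definition horizontal_cells ::
    "('h, 'v, 'c, 'x) double_category_data_scheme \<Rightarrow> ('v, 'c) monoidal_data" where
  "horizontal_cells D =
     \<lparr>Ob = carrier (VEdges D),
      Arr = {\<alpha> \<in> Cells D. Top_edge D \<alpha> = \<one>\<^bsub>HEdges D\<^esub> \<and> Bottom_edge D \<alpha> = \<one>\<^bsub>HEdges D\<^esub>},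
      Dom = Left_edge D,
      Cod = Right_edge D,
      Ident = VEdge_id D,
      Comp = hcomp D,
      TUnit = \<one>\<^bsub>VEdges D\<^esub>,
      TOb = (\<otimes>\<^bsub>VEdges D\<^esub>),
      TArr = vcomp D\<rparr>"

lemma (in single_object_double_category) horizontal_cells_strict_monoidal:
  "strict_monoidal_category (horizontal_cells D)"
proof -
  interpret H: Group.monoid "HEdges D" by (rule HEdges_monoid)
  interpret V: Group.monoid "VEdges D" by (rule VEdges_monoid)
  have om: "object_monoid (horizontal_cells D) =
      \<lparr>carrier = carrier (VEdges D), monoid.mult = (\<otimes>\<^bsub>VEdges D\<^esub>), one = \<one>\<^bsub>VEdges D\<^esub>\<rparr>"
    by (simp add: object_monoid_def horizontal_cells_def)
  have mon: "Group.monoid (object_monoid (horizontal_cells D))"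
    unfolding om by unfold_locales (simp_all add: V.m_assoc)
  have units: "vcomp D (VEdge_id D \<one>\<^bsub>VEdges D\<^esub>) f = f" "vcomp D f (VEdge_id D \<one>\<^bsub>VEdges D\<^esub>) = f"
    if "f \<in> Cells D" "Top_edge D f = \<one>\<^bsub>HEdges D\<^esub>" "Bottom_edge D f = \<one>\<^bsub>HEdges D\<^esub>" for f
    using vcomp_unit_top[of f] vcomp_unit_bottom[of f] that by (simp_all add: unit_ids_coincide)
  have "category (horizontal_cells D)"
    by (rule category.intro)
      (auto simp: horizontal_cells_def boundary_closed VEdge_id hcomp hcomp_assoc
        hcomp_unit_left hcomp_unit_right)
  then show ?thesis
  proof (rule strict_monoidal_category.intro)
    show "strict_monoidal_category_axioms (horizontal_cells D)"
    proof (rule strict_monoidal_category_axioms.intro, rule mon)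
    qed (auto simp: horizontal_cells_def VEdge_id vcomp vcomp_assoc VEdge_id_mult interchange units)
  qed
qed


section \<open>The free cornering\<close>

datatype polarity = Circ | Bullet

type_synonym 'o vedge = "('o \<times> polarity) list"

definition vedge_monoid :: "('o, 'a, 'x) category_data_scheme \<Rightarrow> 'o vedge monoid" where
  "vedge_monoid A = \<lparr>carrier = lists (Ob A \<times> UNIV), monoid.mult = (@), one = []\<rparr>"

text \<open>Formal composites of the generating cells. \<open>Send p\<close> and \<open>Recv p\<close> are the corners
  $s^p$ and $r^p$, and \<open>Box f\<close> is the cell of the morphism \<open>f\<close>.\<close>

datatype ('o, 'a) cell_term =
    Send polarity 'o
  | Recv polarity 'o
  | Box 'a
  | HId 'o
  | VId "'o vedge"
  | HComp "('o, 'a) cell_term" "('o, 'a) cell_term"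
  | VComp "('o, 'a) cell_term" "('o, 'a) cell_term"

primrec term_top :: "('o, 'a, 'x) monoidal_data_scheme \<Rightarrow> ('o, 'a) cell_term \<Rightarrow> 'o" where
  "term_top A (Send p a) = a"
| "term_top A (Recv p a) = TUnit A"
| "term_top A (Box f) = Dom A f"
| "term_top A (HId a) = a"
| "term_top A (VId x) = TUnit A"
| "term_top A (HComp s t) = TOb A (term_top A s) (term_top A t)"
| "term_top A (VComp s t) = term_top A s"

primrec term_bottom :: "('o, 'a, 'x) monoidal_data_scheme \<Rightarrow> ('o, 'a) cell_term \<Rightarrow> 'o" where
  "term_bottom A (Send p a) = TUnit A"
| "term_bottom A (Recv p a) = a"
| "term_bottom A (Box f) = Cod A f"
| "term_bottom A (HId a) = a"
| "term_bottom A (VId x) = TUnit A"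
| "term_bottom A (HComp s t) = TOb A (term_bottom A s) (term_bottom A t)"
| "term_bottom A (VComp s t) = term_bottom A t"

primrec term_left :: "('o, 'a) cell_term \<Rightarrow> 'o vedge" where
  "term_left (Send p a) = (case p of Circ \<Rightarrow> [] | Bullet \<Rightarrow> [(a, Bullet)])"
| "term_left (Recv p a) = (case p of Circ \<Rightarrow> [(a, Circ)] | Bullet \<Rightarrow> [])"
| "term_left (Box f) = []"
| "term_left (HId a) = []"
| "term_left (VId x) = x"
| "term_left (HComp s t) = term_left s"
| "term_left (VComp s t) = term_left s @ term_left t"

primrec term_right :: "('o, 'a) cell_term \<Rightarrow> 'o vedge" where
  "term_right (Send p a) = (case p of Circ \<Rightarrow> [(a, Circ)] | Bullet \<Rightarrow> [])"
| "term_right (Recv p a) = (case p of Circ \<Rightarrow> [] | Bullet \<Rightarrow> [(a, Bullet)])"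
| "term_right (Box f) = []"
| "term_right (HId a) = []"
| "term_right (VId x) = x"
| "term_right (HComp s t) = term_right t"
| "term_right (VComp s t) = term_right s @ term_right t"

primrec well_formed :: "('o, 'a, 'x) monoidal_data_scheme \<Rightarrow> ('o, 'a) cell_term \<Rightarrow> bool" where
  "well_formed A (Send p a) \<longleftrightarrow> a \<in> Ob A"
| "well_formed A (Recv p a) \<longleftrightarrow> a \<in> Ob A"
| "well_formed A (Box f) \<longleftrightarrow> f \<in> Arr A"
| "well_formed A (HId a) \<longleftrightarrow> a \<in> Ob A"
| "well_formed A (VId x) \<longleftrightarrow> x \<in> lists (Ob A \<times> UNIV)"
| "well_formed A (HComp s t) \<longleftrightarrow>
     well_formed A s \<and> well_formed A t \<and> term_right s = term_left t"
| "well_formed A (VComp s t) \<longleftrightarrow>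
     well_formed A s \<and> well_formed A t \<and> term_bottom A s = term_top A t"

text \<open>The congruence generated by the laws of single-object double categories (\<open>h_assoc\<close> to
  \<open>interchange\<close>) and by the defining equations of the free cornering (\<open>yank_h_circ\<close> to
  \<open>box_tensor\<close>).\<close>

inductive cell_eq ::
    "('o, 'a, 'x) monoidal_data_scheme \<Rightarrow> ('o, 'a) cell_term \<Rightarrow> ('o, 'a) cell_term \<Rightarrow> bool"
  for A where
  refl: "well_formed A t \<Longrightarrow> cell_eq A t t"
| sym: "cell_eq A s t \<Longrightarrow> cell_eq A t s"
| trans: "\<lbrakk>cell_eq A s t; cell_eq A t u\<rbrakk> \<Longrightarrow> cell_eq A s u"
| h_cong: "\<lbrakk>cell_eq A s s'; cell_eq A t t'; term_right s = term_left t\<rbrakk>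
    \<Longrightarrow> cell_eq A (HComp s t) (HComp s' t')"
| v_cong: "\<lbrakk>cell_eq A s s'; cell_eq A t t'; term_bottom A s = term_top A t\<rbrakk>
    \<Longrightarrow> cell_eq A (VComp s t) (VComp s' t')"
| h_assoc: "well_formed A (HComp (HComp s t) u)
    \<Longrightarrow> cell_eq A (HComp (HComp s t) u) (HComp s (HComp t u))"
| h_unit_left: "well_formed A t \<Longrightarrow> cell_eq A (HComp (VId (term_left t)) t) t"
| h_unit_right: "well_formed A t \<Longrightarrow> cell_eq A (HComp t (VId (term_right t))) t"
| v_assoc: "well_formed A (VComp (VComp s t) u)
    \<Longrightarrow> cell_eq A (VComp (VComp s t) u) (VComp s (VComp t u))"
| v_unit_top: "well_formed A t \<Longrightarrow> cell_eq A (VComp (HId (term_top A t)) t) t"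
| v_unit_bottom: "well_formed A t \<Longrightarrow> cell_eq A (VComp t (HId (term_bottom A t))) t"
| hid_mult: "\<lbrakk>a \<in> Ob A; b \<in> Ob A\<rbrakk> \<Longrightarrow> cell_eq A (HComp (HId a) (HId b)) (HId (TOb A a b))"
| vid_mult: "\<lbrakk>x \<in> lists (Ob A \<times> UNIV); y \<in> lists (Ob A \<times> UNIV)\<rbrakk>
    \<Longrightarrow> cell_eq A (VComp (VId x) (VId y)) (VId (x @ y))"
| unit_ids: "cell_eq A (HId (TUnit A)) (VId [])"
| interchange: "\<lbrakk>well_formed A (HComp (VComp s t) (VComp u v));
      well_formed A (VComp (HComp s u) (HComp t v))\<rbrakk>
    \<Longrightarrow> cell_eq A (HComp (VComp s t) (VComp u v)) (VComp (HComp s u) (HComp t v))"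
| yank_h_circ: "a \<in> Ob A \<Longrightarrow> cell_eq A (HComp (Send Circ a) (Recv Circ a)) (HId a)"
| yank_v_circ: "a \<in> Ob A \<Longrightarrow> cell_eq A (VComp (Recv Circ a) (Send Circ a)) (VId [(a, Circ)])"
| yank_h_bullet: "a \<in> Ob A \<Longrightarrow> cell_eq A (HComp (Recv Bullet a) (Send Bullet a)) (HId a)"
| yank_v_bullet: "a \<in> Ob A \<Longrightarrow> cell_eq A (VComp (Recv Bullet a) (Send Bullet a)) (VId [(a, Bullet)])"
| box_comp: "\<lbrakk>f \<in> Arr A; g \<in> Arr A; Cod A f = Dom A g\<rbrakk>
    \<Longrightarrow> cell_eq A (VComp (Box f) (Box g)) (Box (Comp A f g))"
| box_ident: "a \<in> Ob A \<Longrightarrow> cell_eq A (Box (Ident A a)) (HId a)"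
| box_tensor: "\<lbrakk>f \<in> Arr A; g \<in> Arr A\<rbrakk>
    \<Longrightarrow> cell_eq A (HComp (Box f) (Box g)) (Box (TArr A f g))"

definition cell_class ::
    "('o, 'a, 'x) monoidal_data_scheme \<Rightarrow> ('o, 'a) cell_term \<Rightarrow> ('o, 'a) cell_term set" where
  "cell_class A t = {s. cell_eq A t s}"

definition cell_rep :: "('o, 'a) cell_term set \<Rightarrow> ('o, 'a) cell_term" where
  "cell_rep c = (SOME t. t \<in> c)"

text \<open>Boundaries and composites are computed on representatives; independence of the choice is
  shown below.\<close>

definition free_cornering :: "('o, 'a, 'x) monoidal_data_scheme \<Rightarrow>
    ('o, 'o vedge, ('o, 'a) cell_term set) double_category_data" where
  "free_cornering A =
     \<lparr>HEdges = object_monoid A,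
      VEdges = vedge_monoid A,
      Cells = cell_class A ` {t. well_formed A t},
      Top_edge = (\<lambda>c. term_top A (cell_rep c)),
      Bottom_edge = (\<lambda>c. term_bottom A (cell_rep c)),
      Left_edge = (\<lambda>c. term_left (cell_rep c)),
      Right_edge = (\<lambda>c. term_right (cell_rep c)),
      HEdge_id = (\<lambda>a. cell_class A (HId a)),
      VEdge_id = (\<lambda>x. cell_class A (VId x)),
      hcomp = (\<lambda>c d. cell_class A (HComp (cell_rep c) (cell_rep d))),
      vcomp = (\<lambda>c d. cell_class A (VComp (cell_rep c) (cell_rep d)))\<rparr>"

context strict_monoidal_category
begin

lemma TOb_simps:
  "TUnit C \<in> Ob C"
  "\<lbrakk>X \<in> Ob C; Y \<in> Ob C\<rbrakk> \<Longrightarrow> TOb C X Y \<in> Ob C"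
  "\<lbrakk>X \<in> Ob C; Y \<in> Ob C; Z \<in> Ob C\<rbrakk> \<Longrightarrow> TOb C (TOb C X Y) Z = TOb C X (TOb C Y Z)"
  "X \<in> Ob C \<Longrightarrow> TOb C (TUnit C) X = X"
  "X \<in> Ob C \<Longrightarrow> TOb C X (TUnit C) = X"
  using object_monoid unfolding Group.monoid_def object_monoid_def by simp_all

lemma well_formed_boundary:
  "well_formed C t \<Longrightarrow> term_top C t \<in> Ob C \<and> term_bottom C t \<in> Ob C \<and>
     term_left t \<in> lists (Ob C \<times> UNIV) \<and> term_right t \<in> lists (Ob C \<times> UNIV)"
  by (induction t) (auto simp: TOb_simps Dom_closed Cod_closed split: polarity.split)

lemma cell_eq_boundary:
  "cell_eq C s t \<Longrightarrow> well_formed C s \<and> well_formed C t \<and>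
     term_top C s = term_top C t \<and> term_bottom C s = term_bottom C t \<and>
     term_left s = term_left t \<and> term_right s = term_right t"
  by (induction rule: cell_eq.induct)
    (auto simp: TOb_simps Dom_closed Cod_closed Comp_closed Dom_Comp Cod_Comp Ident_closed Dom_Ident
      Cod_Ident TArr_closed Dom_TArr Cod_TArr dest!: well_formed_boundary)

lemma cell_class_eq_iff:
  assumes "well_formed C s" "well_formed C t"
  shows "cell_class C s = cell_class C t \<longleftrightarrow> cell_eq C s t"
  using assms unfolding cell_class_def
  by (auto intro: cell_eq.refl cell_eq.sym cell_eq.trans)

lemma cell_eq_rep:
  assumes "well_formed C t"
  shows "cell_eq C t (cell_rep (cell_class C t))"
proof -
  have "t \<in> cell_class C t" using assms by (simp add: cell_class_def cell_eq.refl)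
  then have "cell_rep (cell_class C t) \<in> cell_class C t" unfolding cell_rep_def by (rule someI)
  then show ?thesis by (simp add: cell_class_def)
qed

lemma cell_rep_boundary:
  assumes "well_formed C t"
  shows "term_top C (cell_rep (cell_class C t)) = term_top C t"
    and "term_bottom C (cell_rep (cell_class C t)) = term_bottom C t"
    and "term_left (cell_rep (cell_class C t)) = term_left t"
    and "term_right (cell_rep (cell_class C t)) = term_right t"
  using cell_eq_boundary[OF cell_eq_rep[OF assms]] by simp_all

lemma cell_eqD: "cell_eq C s t \<Longrightarrow> cell_class C s = cell_class C t"
  using cell_class_eq_iff cell_eq_boundary by blast

lemma free_cornering_simps:
  "HEdges (free_cornering C) = object_monoid C"
  "VEdges (free_cornering C) = vedge_monoid C"
  "Cells (free_cornering C) = cell_class C ` {t. well_formed C t}"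
  "HEdge_id (free_cornering C) a = cell_class C (HId a)"
  "VEdge_id (free_cornering C) x = cell_class C (VId x)"
  by (simp_all add: free_cornering_def)

lemma free_cornering_boundary:
  assumes "well_formed C t"
  shows "Top_edge (free_cornering C) (cell_class C t) = term_top C t"
    and "Bottom_edge (free_cornering C) (cell_class C t) = term_bottom C t"
    and "Left_edge (free_cornering C) (cell_class C t) = term_left t"
    and "Right_edge (free_cornering C) (cell_class C t) = term_right t"
  using cell_rep_boundary[OF assms] by (simp_all add: free_cornering_def)

lemma free_cornering_hcomp:
  assumes "well_formed C s" "well_formed C t" "term_right s = term_left t"
  shows "hcomp (free_cornering C) (cell_class C s) (cell_class C t) = cell_class C (HComp s t)"
  using assms
  by (auto simp: free_cornering_def intro!: cell_eqD[symmetric] cell_eq.h_cong cell_eq_rep)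

lemma free_cornering_vcomp:
  assumes "well_formed C s" "well_formed C t" "term_bottom C s = term_top C t"
  shows "vcomp (free_cornering C) (cell_class C s) (cell_class C t) = cell_class C (VComp s t)"
  using assms
  by (auto simp: free_cornering_def intro!: cell_eqD[symmetric] cell_eq.v_cong cell_eq_rep)

theorem free_cornering_double_category:
  "single_object_double_category (free_cornering C)"
proof -
  note fc = free_cornering_simps free_cornering_boundary free_cornering_hcomp free_cornering_vcomp
  have H: "carrier (object_monoid C) = Ob C" "\<one>\<^bsub>object_monoid C\<^esub> = TUnit C"
    "a \<otimes>\<^bsub>object_monoid C\<^esub> b = TOb C a b" for a b
    by (simp_all add: object_monoid_def)
  have V: "carrier (vedge_monoid C) = lists (Ob C \<times> UNIV)" "\<one>\<^bsub>vedge_monoid C\<^esub> = []"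
    "x \<otimes>\<^bsub>vedge_monoid C\<^esub> y = x @ y" for x y
    by (simp_all add: vedge_monoid_def)
  have M: "Group.monoid (vedge_monoid C)"
    unfolding vedge_monoid_def by unfold_locales auto
  have wf: "term_top C t \<in> Ob C" "term_bottom C t \<in> Ob C"
    "term_left t \<in> lists (Ob C \<times> UNIV)" "term_right t \<in> lists (Ob C \<times> UNIV)"
    if "well_formed C t" for t
    using well_formed_boundary[OF that] by blast+
  have wf': "(a, p) \<in> set (term_left t) \<Longrightarrow> a \<in> Ob C"
    "(a, p) \<in> set (term_right t) \<Longrightarrow> a \<in> Ob C" if "well_formed C t" for a p t
    using wf(3,4)[OF that] by auto
  note [simp] = fc H V TOb_simps wf
  show ?thesis
    by (rule single_object_double_category.intro)
      (auto simp: object_monoid M cell_eq.intros(6-15)[THEN cell_eqD] dest: wf')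
qed

end

end

theory Submission
  imports Defs
begin

text \<open>The involution reflects cells in a vertical axis, exchanging \<open>Send Circ\<close> with
  \<open>Send Bullet\<close> and \<open>Recv Circ\<close> with \<open>Recv Bullet\<close>. Reflection also reverses the order of the
  top and bottom boundaries, which would turn the image of a box \<open>f\<close> into one for the reversed
  tensor product; so each reflected horizontal composite is conjugated by symmetries, which restores
  the order of its boundaries. Naturality, the Yang--Baxter equation and the unit coherence of the
  symmetry make this respect all defining equations of the free cornering. On horizontal cells the
  conjugating symmetries are the identity of the unit, so there the reflection is a
  contravariant functor.\<close>

context symmetric_strict_monoidal_category
begin

section \<open>Coherence of the symmetry: units, the second hexagon, Yang-Baxter\<close>

lemmas arrow_simps = Dom_closed Cod_closed Ident_closed Dom_Ident Cod_Ident Comp_closed Dom_Comp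
  Cod_Comp TArr_closed Dom_TArr Cod_TArr Sym_closed Dom_Sym Cod_Sym TOb_simps

lemma Comp_Ident_left': "\<lbrakk>f \<in> Arr C; Dom C f = X\<rbrakk> \<Longrightarrow> Comp C (Ident C X) f = f"
  using Comp_Ident_left by blast

lemma Comp_Ident_right': "\<lbrakk>f \<in> Arr C; Cod C f = X\<rbrakk> \<Longrightarrow> Comp C f (Ident C X) = f"
  using Comp_Ident_right by blast

text \<open>The hexagon with both of its last two objects the unit makes this symmetry idempotent
  under composition, and an invertible idempotent is an identity.\<close>

lemma Sym_unit_right:
  assumes "X \<in> Ob C"
  shows "Sym C X (TUnit C) = Ident C X"
proof -
  let ?s = "Sym C X (TUnit C)" and ?s' = "Sym C (TUnit C) X"
  have s: "?s \<in> Arr C" "?s' \<in> Arr C" "Dom C ?s = X" "Cod C ?s = X" "Dom C ?s' = X" "Cod C ?s' = X"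
    using assms by (simp_all add: arrow_simps)
  have "?s = Comp C ?s ?s"
    using Sym_hexagon[OF assms, of "TUnit C" "TUnit C"] s
    by (simp add: arrow_simps TArr_unit_left TArr_unit_right)
  then have "Comp C ?s ?s' = Comp C ?s (Comp C ?s ?s')"
    using Comp_assoc[of ?s ?s ?s'] s by simp
  moreover have "Comp C ?s ?s' = Ident C X"
    using Sym_involutive[of X "TUnit C"] assms by (simp add: arrow_simps)
  ultimately show ?thesis
    using s by (simp add: Comp_Ident_right')
qed

lemma Sym_unit_left:
  assumes "X \<in> Ob C"
  shows "Sym C (TUnit C) X = Ident C X"
  using Sym_involutive[of X "TUnit C"] assms
  by (simp add: arrow_simps Sym_unit_right Comp_Ident_left')

text \<open>Both sides are inverse to \<open>Sym C Z (TOb C X Y)\<close>: the left one by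
  involutivity, the right one because the given hexagon factors that symmetry as \<open>q'\<close>
  followed by \<open>p'\<close>, the inverses of \<open>q\<close> and \<open>p\<close>. Uniqueness
  of inverses does the rest.\<close>

lemma Sym_hexagon':
  assumes [simp]: "X \<in> Ob C" "Y \<in> Ob C" "Z \<in> Ob C"
  shows "Sym C (TOb C X Y) Z
    = Comp C (TArr C (Ident C X) (Sym C Y Z)) (TArr C (Sym C X Z) (Ident C Y))"
proof -
  note [simp] = arrow_simps
  define p where "p = TArr C (Ident C X) (Sym C Y Z)"
  define q where "q = TArr C (Sym C X Z) (Ident C Y)"
  define p' where "p' = TArr C (Ident C X) (Sym C Z Y)"
  define q' where "q' = TArr C (Sym C Z X) (Ident C Y)"
  define s where "s = Sym C (TOb C X Y) Z"
  have arr: "p \<in> Arr C" "q \<in> Arr C" "p' \<in> Arr C" "q' \<in> Arr C" "s \<in> Arr C"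
    "Dom C p = TOb C X (TOb C Y Z)" "Cod C p = TOb C X (TOb C Z Y)"
    "Dom C q = TOb C X (TOb C Z Y)" "Cod C q = TOb C Z (TOb C X Y)"
    "Dom C p' = TOb C X (TOb C Z Y)" "Cod C p' = TOb C X (TOb C Y Z)"
    "Dom C q' = TOb C Z (TOb C X Y)" "Cod C q' = TOb C X (TOb C Z Y)"
    "Dom C s = TOb C X (TOb C Y Z)" "Cod C s = TOb C Z (TOb C X Y)"
    by (simp_all add: p_def q_def p'_def q'_def s_def)
  have pp: "Comp C p p' = Ident C (TOb C X (TOb C Y Z))"
    unfolding p_def p'_def
    by (subst TArr_Comp[symmetric]) (simp_all add: Comp_Ident_left' Sym_involutive TArr_Ident)
  have qq: "Comp C q q' = Ident C (TOb C X (TOb C Z Y))"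
    unfolding q_def q'_def
    by (subst TArr_Comp[symmetric]) (simp_all add: Comp_Ident_left' Sym_involutive TArr_Ident)
  have hex: "Sym C Z (TOb C X Y) = Comp C q' p'"
    using Sym_hexagon[of Z X Y] by (simp add: q'_def p'_def)
  have "Comp C (Sym C Z (TOb C X Y)) s = Ident C (TOb C Z (TOb C X Y))"
    using Sym_involutive[of Z "TOb C X Y"] by (simp add: s_def)
  then have inv: "Comp C (Comp C q' p') s = Ident C (TOb C Z (TOb C X Y))"
    by (simp add: hex)
  \<comment> \<open>The composite \<open>p\<close>, \<open>q\<close>, \<open>q'\<close>,
    \<open>p'\<close>, \<open>s\<close> is evaluated in two ways: its first four factors cancel from
    the inside out and leave \<open>s\<close>, while its last three cancel by \<open>inv\<close> and
    leave \<open>p\<close> followed by \<open>q\<close>.\<close>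
  have "Comp C (Comp C p q) (Comp C q' p') = Comp C p (Comp C (Comp C q q') p')"
    using arr by (simp add: Comp_assoc)
  also have "\<dots> = Ident C (TOb C X (TOb C Y Z))"
    using arr by (simp add: qq pp Comp_Ident_left')
  finally have "Comp C (Comp C (Comp C p q) (Comp C q' p')) s = s"
    using arr by (simp add: Comp_Ident_left')
  moreover have "Comp C (Comp C (Comp C p q) (Comp C q' p')) s
      = Comp C (Comp C p q) (Comp C (Comp C q' p') s)"
    using arr by (intro Comp_assoc) simp_all
  ultimately have "s = Comp C p q"
    using arr by (simp add: inv Comp_Ident_right')
  then show ?thesis by (simp add: s_def p_def q_def)
qed

text \<open>Expanding the left-hand symmetry by \<open>Sym_hexagon'\<close> exposes two factors that
  the other hexagon contracts to \<open>Sym C X (TOb C Z Y)\<close>; naturality then moves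
  \<open>Sym C Y Z\<close> across it.\<close>

lemma Yang_Baxter:
  assumes [simp]: "X \<in> Ob C" "Y \<in> Ob C" "Z \<in> Ob C"
  shows "Comp C (Sym C (TOb C X Y) Z) (TArr C (Ident C Z) (Sym C X Y))
    = Comp C (Sym C X (TOb C Y Z)) (TArr C (Sym C Y Z) (Ident C X))"
proof -
  note [simp] = arrow_simps
  have "Comp C (Sym C (TOb C X Y) Z) (TArr C (Ident C Z) (Sym C X Y))
      = Comp C (TArr C (Ident C X) (Sym C Y Z)) (Sym C X (TOb C Z Y))"
    by (simp add: Sym_hexagon' Sym_hexagon[of X Z Y] Comp_assoc)
  also have "\<dots> = Comp C (Sym C X (TOb C Y Z)) (TArr C (Sym C Y Z) (Ident C X))"
    using Sym_natural[of "Ident C X" "Sym C Y Z"] by simp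
  finally show ?thesis .
qed

text \<open>The form needed at bottom boundaries, where the large symmetry comes last. Naturality on
  each side turns it into \<open>Yang_Baxter\<close>.\<close>

lemma Yang_Baxter':
  assumes [simp]: "X \<in> Ob C" "Y \<in> Ob C" "Z \<in> Ob C"
  shows "Comp C (TArr C (Ident C X) (Sym C Y Z)) (Sym C X (TOb C Z Y))
    = Comp C (TArr C (Sym C X Y) (Ident C Z)) (Sym C (TOb C Y X) Z)"
  using Yang_Baxter[of X Y Z] Sym_natural[of "Ident C X" "Sym C Y Z"]
    Sym_natural[of "Sym C X Y" "Ident C Z"]
  by (simp add: arrow_simps)

section \<open>Boundaries and boxes in the free cornering\<close>

interpretation FC: single_object_double_category "free_cornering C"
  by (rule free_cornering_double_category)

abbreviation hcomp_infix (infixr "\<parallel>" 65) where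
  "\<alpha> \<parallel> \<beta> \<equiv> hcomp (free_cornering C) \<alpha> \<beta>"

abbreviation vcomp_infix (infixr "\<then>" 60) where
  "\<alpha> \<then> \<beta> \<equiv> vcomp (free_cornering C) \<alpha> \<beta>"

abbreviation "cells \<equiv> Cells (free_cornering C)"
abbreviation "top_edge \<equiv> Top_edge (free_cornering C)"
abbreviation "bottom_edge \<equiv> Bottom_edge (free_cornering C)"
abbreviation "left_edge \<equiv> Left_edge (free_cornering C)"
abbreviation "right_edge \<equiv> Right_edge (free_cornering C)"
abbreviation "hid \<equiv> HEdge_id (free_cornering C)"
abbreviation "vid \<equiv> VEdge_id (free_cornering C)"

lemma edge_monoid_simps:
  "carrier (HEdges (free_cornering C)) = Ob C"
  "\<one>\<^bsub>HEdges (free_cornering C)\<^esub> = TUnit C"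
  "a \<otimes>\<^bsub>HEdges (free_cornering C)\<^esub> b = TOb C a b"
  "carrier (VEdges (free_cornering C)) = lists (Ob C \<times> UNIV)"
  "\<one>\<^bsub>VEdges (free_cornering C)\<^esub> = []"
  "x \<otimes>\<^bsub>VEdges (free_cornering C)\<^esub> y = x @ y"
  by (simp_all add: free_cornering_def object_monoid_def vedge_monoid_def)

lemma top_Ob: "\<alpha> \<in> cells \<Longrightarrow> top_edge \<alpha> \<in> Ob C"
  and bottom_Ob: "\<alpha> \<in> cells \<Longrightarrow> bottom_edge \<alpha> \<in> Ob C"
  and left_vedge: "\<alpha> \<in> cells \<Longrightarrow> left_edge \<alpha> \<in> lists (Ob C \<times> UNIV)"
  and right_vedge: "\<alpha> \<in> cells \<Longrightarrow> right_edge \<alpha> \<in> lists (Ob C \<times> UNIV)"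
  using FC.boundary_closed[of \<alpha>] unfolding edge_monoid_simps by blast+

lemmas cell_simps = top_Ob bottom_Ob left_vedge right_vedge
  FC.hcomp[unfolded edge_monoid_simps] FC.vcomp[unfolded edge_monoid_simps]
  FC.HEdge_id[unfolded edge_monoid_simps] FC.VEdge_id[unfolded edge_monoid_simps]

definition box where "box f = cell_class C (Box f)"

lemma box_simps:
  assumes "f \<in> Arr C"
  shows "box f \<in> cells" "top_edge (box f) = Dom C f" "bottom_edge (box f) = Cod C f"
    "left_edge (box f) = []" "right_edge (box f) = []"
  using assms by (auto simp: box_def free_cornering_simps free_cornering_boundary)

lemma box_Comp:
  assumes "f \<in> Arr C" "g \<in> Arr C" "Cod C f = Dom C g"
  shows "box f \<then> box g = box (Comp C f g)"
  using assms unfolding box_def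
  by (simp add: free_cornering_vcomp cell_eqD cell_eq.box_comp)

lemma box_TArr:
  assumes "f \<in> Arr C" "g \<in> Arr C"
  shows "box f \<parallel> box g = box (TArr C f g)"
  using assms unfolding box_def
  by (simp add: free_cornering_hcomp cell_eqD cell_eq.box_tensor)

lemma box_Ident: "a \<in> Ob C \<Longrightarrow> box (Ident C a) = hid a"
  by (simp add: box_def free_cornering_simps cell_eqD cell_eq.box_ident)

lemma box_Ident_vcomp: "\<lbrakk>\<alpha> \<in> cells; top_edge \<alpha> = a\<rbrakk> \<Longrightarrow> box (Ident C a) \<then> \<alpha> = \<alpha>"
  by (drule HOL.sym) (simp add: box_Ident top_Ob FC.vcomp_unit_top)

lemma vcomp_box_Ident: "\<lbrakk>\<alpha> \<in> cells; bottom_edge \<alpha> = a\<rbrakk> \<Longrightarrow> \<alpha> \<then> box (Ident C a) = \<alpha>"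
  by (drule HOL.sym) (simp add: box_Ident bottom_Ob FC.vcomp_unit_bottom)

section \<open>Conjugation by boxes and twisted horizontal composition\<close>

definition box_conj where "box_conj f \<alpha> g = box f \<then> \<alpha> \<then> box g"

lemma box_conj_simps:
  assumes "f \<in> Arr C" "\<alpha> \<in> cells" "g \<in> Arr C" "Cod C f = top_edge \<alpha>" "Dom C g = bottom_edge \<alpha>"
  shows "box_conj f \<alpha> g \<in> cells" "top_edge (box_conj f \<alpha> g) = Dom C f"
    "bottom_edge (box_conj f \<alpha> g) = Cod C g" "left_edge (box_conj f \<alpha> g) = left_edge \<alpha>"
    "right_edge (box_conj f \<alpha> g) = right_edge \<alpha>"
  using assms by (simp_all add: box_conj_def cell_simps box_simps)

lemma box_conj_Ident:
  assumes "\<alpha> \<in> cells" "top_edge \<alpha> = a" "bottom_edge \<alpha> = b"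
  shows "box_conj (Ident C a) \<alpha> (Ident C b) = \<alpha>"
  using assms by (simp add: box_conj_def vcomp_box_Ident box_Ident_vcomp)

lemma box_conj_box_conj:
  assumes "f \<in> Arr C" "f' \<in> Arr C" "\<alpha> \<in> cells" "g \<in> Arr C" "g' \<in> Arr C"
    "Cod C f' = Dom C f" "Cod C f = top_edge \<alpha>" "Dom C g = bottom_edge \<alpha>" "Dom C g' = Cod C g"
  shows "box_conj f' (box_conj f \<alpha> g) g' = box_conj (Comp C f' f) \<alpha> (Comp C g g')"
proof -
  have "box_conj f' (box_conj f \<alpha> g) g' = (box f' \<then> box f) \<then> \<alpha> \<then> (box g \<then> box g')"
    using assms by (simp add: box_conj_def FC.vcomp_assoc cell_simps box_simps)
  then show ?thesis
    using assms by (simp add: box_conj_def box_Comp)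
qed

text \<open>Interchange is used twice, once to split off the two upper boxes and once the two lower
  ones; each pair of neighbouring boxes then merges into the box of a tensor product.\<close>

lemma hcomp_box_conj:
  assumes "f \<in> Arr C" "\<alpha> \<in> cells" "g \<in> Arr C" "Cod C f = top_edge \<alpha>" "Dom C g = bottom_edge \<alpha>"
    "f' \<in> Arr C" "\<beta> \<in> cells" "g' \<in> Arr C" "Cod C f' = top_edge \<beta>" "Dom C g' = bottom_edge \<beta>"
    "right_edge \<alpha> = left_edge \<beta>"
  shows "box_conj f \<alpha> g \<parallel> box_conj f' \<beta> g'
    = box_conj (TArr C f f') (\<alpha> \<parallel> \<beta>) (TArr C g g')"
  using assms by (simp add: box_conj_def FC.interchange cell_simps box_simps box_TArr)

text \<open>The boxes of \<open>g\<close> and \<open>g'\<close> meet in the middle and compose to an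
  identity cell.\<close>

lemma vcomp_box_conj:
  assumes "f \<in> Arr C" "\<alpha> \<in> cells" "g \<in> Arr C" "Cod C f = top_edge \<alpha>" "Dom C g = bottom_edge \<alpha>"
    "g' \<in> Arr C" "\<beta> \<in> cells" "h \<in> Arr C" "Cod C g' = top_edge \<beta>" "Dom C h = bottom_edge \<beta>"
    "bottom_edge \<alpha> = top_edge \<beta>" "Comp C g g' = Ident C (top_edge \<beta>)" "Cod C g = Dom C g'"
  shows "box_conj f \<alpha> g \<then> box_conj g' \<beta> h = box_conj f (\<alpha> \<then> \<beta>) h"
proof -
  have "box_conj f \<alpha> g \<then> box_conj g' \<beta> h = box f \<then> \<alpha> \<then> (box g \<then> box g') \<then> \<beta> \<then> box h"
    using assms by (simp add: box_conj_def FC.vcomp_assoc cell_simps box_simps)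
  also have "\<dots> = box f \<then> \<alpha> \<then> \<beta> \<then> box h"
    using assms by (simp add: box_Comp box_Ident_vcomp cell_simps box_simps)
  finally show ?thesis
    using assms by (simp add: box_conj_def FC.vcomp_assoc cell_simps box_simps)
qed

text \<open>The arguments stand in the order of the composite before reflection, so the cells
  themselves are composed in the opposite order. The lower symmetry takes \<open>\<beta>\<close>
  first because it has to undo the swap made by the upper one.\<close>

definition twist where
  "twist \<alpha> \<beta> = box_conj (Sym C (top_edge \<alpha>) (top_edge \<beta>)) (\<beta> \<parallel> \<alpha>) (Sym C (bottom_edge \<beta>) (bottom_edge \<alpha>))"

lemma twist_simps:
  assumes "\<alpha> \<in> cells" "\<beta> \<in> cells" "left_edge \<alpha> = right_edge \<beta>"
  shows "twist \<alpha> \<beta> \<in> cells" "top_edge (twist \<alpha> \<beta>) = TOb C (top_edge \<alpha>) (top_edge \<beta>)"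
    "bottom_edge (twist \<alpha> \<beta>) = TOb C (bottom_edge \<alpha>) (bottom_edge \<beta>)"
    "left_edge (twist \<alpha> \<beta>) = left_edge \<beta>" "right_edge (twist \<alpha> \<beta>) = right_edge \<alpha>"
  using assms by (simp_all add: twist_def box_conj_simps cell_simps arrow_simps)

text \<open>Both bracketings are conjugates of the single composite of \<open>\<gamma>\<close>,
  \<open>\<beta>\<close>, \<open>\<alpha>\<close> in this order. The upper conjugating arrows agree
  by \<open>Yang_Baxter\<close>, the lower ones by \<open>Yang_Baxter'\<close>.\<close>

lemma twist_assoc:
  assumes "\<alpha> \<in> cells" "\<beta> \<in> cells" "\<gamma> \<in> cells" "left_edge \<alpha> = right_edge \<beta>" "left_edge \<beta> = right_edge \<gamma>"
  shows "twist (twist \<alpha> \<beta>) \<gamma> = twist \<alpha> (twist \<beta> \<gamma>)"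
proof -
  note [simp] = cell_simps arrow_simps box_conj_simps assms
  have "\<gamma> \<parallel> twist \<alpha> \<beta> = box_conj (TArr C (Ident C (top_edge \<gamma>)) (Sym C (top_edge \<alpha>) (top_edge \<beta>)))
      (\<gamma> \<parallel> \<beta> \<parallel> \<alpha>) (TArr C (Ident C (bottom_edge \<gamma>)) (Sym C (bottom_edge \<beta>) (bottom_edge \<alpha>)))"
    \<comment> \<open>The untwisted cell \<open>\<gamma>\<close> is viewed as conjugated by
      identities, so that both factors have the shape required for merging.\<close>
    using hcomp_box_conj[of "Ident C (top_edge \<gamma>)" \<gamma> "Ident C (bottom_edge \<gamma>)"
        "Sym C (top_edge \<alpha>) (top_edge \<beta>)" "\<beta> \<parallel> \<alpha>"
        "Sym C (bottom_edge \<beta>) (bottom_edge \<alpha>)"]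
    by (simp add: twist_def box_conj_Ident)
  then have l: "twist (twist \<alpha> \<beta>) \<gamma>
      = box_conj (Comp C (Sym C (TOb C (top_edge \<alpha>) (top_edge \<beta>)) (top_edge \<gamma>))
            (TArr C (Ident C (top_edge \<gamma>)) (Sym C (top_edge \<alpha>) (top_edge \<beta>))))
          (\<gamma> \<parallel> \<beta> \<parallel> \<alpha>)
          (Comp C (TArr C (Ident C (bottom_edge \<gamma>)) (Sym C (bottom_edge \<beta>) (bottom_edge \<alpha>)))
            (Sym C (bottom_edge \<gamma>) (TOb C (bottom_edge \<alpha>) (bottom_edge \<beta>))))"
    unfolding twist_def[of "twist \<alpha> \<beta>"] by (simp add: twist_simps box_conj_box_conj)
  have "twist \<beta> \<gamma> \<parallel> \<alpha> = box_conj (TArr C (Sym C (top_edge \<beta>) (top_edge \<gamma>)) (Ident C (top_edge \<alpha>)))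
      ((\<gamma> \<parallel> \<beta>) \<parallel> \<alpha>) (TArr C (Sym C (bottom_edge \<gamma>) (bottom_edge \<beta>)) (Ident C (bottom_edge \<alpha>)))"
    using hcomp_box_conj[of "Sym C (top_edge \<beta>) (top_edge \<gamma>)" "\<gamma> \<parallel> \<beta>"
        "Sym C (bottom_edge \<gamma>) (bottom_edge \<beta>)"
        "Ident C (top_edge \<alpha>)" \<alpha> "Ident C (bottom_edge \<alpha>)"]
    by (simp add: twist_def box_conj_Ident)
  then have r: "twist \<alpha> (twist \<beta> \<gamma>)
      = box_conj (Comp C (Sym C (top_edge \<alpha>) (TOb C (top_edge \<beta>) (top_edge \<gamma>)))
            (TArr C (Sym C (top_edge \<beta>) (top_edge \<gamma>)) (Ident C (top_edge \<alpha>))))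
          (\<gamma> \<parallel> \<beta> \<parallel> \<alpha>)
          (Comp C (TArr C (Sym C (bottom_edge \<gamma>) (bottom_edge \<beta>)) (Ident C (bottom_edge \<alpha>)))
            (Sym C (TOb C (bottom_edge \<beta>) (bottom_edge \<gamma>)) (bottom_edge \<alpha>)))"
    unfolding twist_def[of \<alpha>] by (simp add: twist_simps box_conj_box_conj FC.hcomp_assoc)
  show ?thesis
    unfolding l r by (simp add: Yang_Baxter Yang_Baxter')
qed

text \<open>Vertical-edge identities have unit top and bottom, so the conjugating symmetries are
  identities and the unit law of the opposite side remains.\<close>

lemma twist_unit:
  assumes "\<alpha> \<in> cells"
  shows "left_edge \<alpha> = x \<Longrightarrow> twist \<alpha> (vid x) = \<alpha>" "right_edge \<alpha> = x \<Longrightarrow> twist (vid x) \<alpha> = \<alpha>"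
proof -
  note [simp] = cell_simps arrow_simps assms Sym_unit_left Sym_unit_right box_conj_Ident
  show "left_edge \<alpha> = x \<Longrightarrow> twist \<alpha> (vid x) = \<alpha>"
    by (drule HOL.sym) (simp add: twist_def FC.hcomp_unit_left)
  show "right_edge \<alpha> = x \<Longrightarrow> twist (vid x) \<alpha> = \<alpha>"
    by (drule HOL.sym) (simp add: twist_def FC.hcomp_unit_right)
qed

text \<open>The symmetry below the upper twist is inverse to the one above the lower twist; once
  they cancel, ordinary interchange applies to the swapped composites.\<close>

lemma twist_interchange:
  assumes "\<alpha> \<in> cells" "\<beta> \<in> cells" "\<gamma> \<in> cells" "\<delta> \<in> cells" "bottom_edge \<alpha> = top_edge \<beta>"
    "bottom_edge \<gamma> = top_edge \<delta>" "left_edge \<alpha> = right_edge \<gamma>" "left_edge \<beta> = right_edge \<delta>"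
  shows "twist (\<alpha> \<then> \<beta>) (\<gamma> \<then> \<delta>) = (twist \<alpha> \<gamma> \<then> twist \<beta> \<delta>)"
  using assms
  by (simp add: twist_def vcomp_box_conj FC.interchange cell_simps arrow_simps Sym_involutive)

text \<open>Naturality carries the swapped tensor product across the upper symmetry and restores its
  order; the two symmetries are then adjacent and cancel.\<close>

lemma twist_box:
  assumes "f \<in> Arr C" "g \<in> Arr C"
  shows "twist (box f) (box g) = box (TArr C f g)"
proof -
  note [simp] = assms arrow_simps box_simps
  have "twist (box f) (box g)
      = (box (Sym C (Dom C f) (Dom C g)) \<then> box (TArr C g f)) \<then> box (Sym C (Cod C g) (Cod C f))"
    by (simp add: twist_def box_conj_def box_TArr FC.vcomp_assoc)
  also have "\<dots> = box (TArr C f g) \<then> (box (Sym C (Cod C f) (Cod C g)) \<then> box (Sym C (Cod C g) (Cod C f)))"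
    by (simp add: box_Comp Sym_natural[symmetric] Comp_assoc)
  also have "\<dots> = box (TArr C f g)"
    by (simp add: box_Comp Sym_involutive vcomp_box_Ident)
  finally show ?thesis .
qed

lemma twist_hid:
  assumes "a \<in> Ob C" "b \<in> Ob C"
  shows "twist (hid a) (hid b) = hid (TOb C a b)"
  using twist_box[of "Ident C a" "Ident C b"] assms by (simp add: arrow_simps box_Ident TArr_Ident)

text \<open>This covers both composites of horizontal cells and the horizontal yanking equations,
  where one of the two corners has unit top and the other has unit bottom.\<close>

lemma twist_unit_boundary:
  assumes "\<alpha> \<in> cells" "\<beta> \<in> cells" "left_edge \<alpha> = right_edge \<beta>"
    "top_edge \<alpha> = TUnit C \<or> top_edge \<beta> = TUnit C" "bottom_edge \<alpha> = TUnit C \<or> bottom_edge \<beta> = TUnit C"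
  shows "twist \<alpha> \<beta> = \<beta> \<parallel> \<alpha>"
  using assms
  by (auto simp: twist_def Sym_unit_left Sym_unit_right box_conj_Ident cell_simps arrow_simps)

section \<open>Reflection of formal composites\<close>

primrec flip where "flip Circ = Bullet" | "flip Bullet = Circ"

lemma flip_flip: "flip (flip p) = p"
  by (cases p) simp_all

text \<open>Vertical edges are read from top to bottom, so a left-right reflection changes
  polarities but keeps the order of the list. This is why the duality does not reverse tensor
  products.\<close>

abbreviation star where "star \<equiv> map (\<lambda>(a, p). (a, flip p))"

lemma star_vedge: "x \<in> lists (Ob C \<times> UNIV) \<Longrightarrow> star x \<in> lists (Ob C \<times> UNIV)"
  by auto

lemma star_star: "star (star x) = x"
  by (induction x) (auto simp: flip_flip)

text \<open>The recursion runs over terms but takes values in cells of the free cornering, so the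
  laws of the double category are available as equations between its values.\<close>

primrec mirror where
  "mirror (Send p a) = cell_class C (Send (flip p) a)"
| "mirror (Recv p a) = cell_class C (Recv (flip p) a)"
| "mirror (Box f) = box f"
| "mirror (HId a) = hid a"
| "mirror (VId x) = vid (star x)"
| "mirror (HComp s t) = twist (mirror s) (mirror t)"
| "mirror (VComp s t) = (mirror s \<then> mirror t)"

lemma corner_simps:
  assumes "a \<in> Ob C"
  shows "cell_class C (Send p a) \<in> cells" "cell_class C (Recv p a) \<in> cells"
    "top_edge (cell_class C (Send p a)) = a" "bottom_edge (cell_class C (Send p a)) = TUnit C"
    "top_edge (cell_class C (Recv p a)) = TUnit C" "bottom_edge (cell_class C (Recv p a)) = a"
    "left_edge (cell_class C (Send p a)) = term_left (Send p a :: ('o, 'a) cell_term)"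
    "right_edge (cell_class C (Send p a)) = term_right (Send p a :: ('o, 'a) cell_term)"
    "left_edge (cell_class C (Recv p a)) = term_left (Recv p a :: ('o, 'a) cell_term)"
    "right_edge (cell_class C (Recv p a)) = term_right (Recv p a :: ('o, 'a) cell_term)"
  using assms by (simp_all add: free_cornering_simps free_cornering_boundary)

text \<open>Horizontally, \<open>Circ\<close> composes send before receive and \<open>Bullet\<close>
  receive before send, so reversing the order and flipping the polarity exchanges the two equations.
  Vertically both polarities have the same shape.\<close>

lemma corner_yanking:
  assumes "a \<in> Ob C"
  shows "cell_class C (Send Circ a) \<parallel> cell_class C (Recv Circ a) = hid a"
    "cell_class C (Recv Bullet a) \<parallel> cell_class C (Send Bullet a) = hid a"
    "(cell_class C (Recv p a) \<then> cell_class C (Send p a)) = vid [(a, p)]"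
  using assms
  by (cases p; simp add: free_cornering_hcomp free_cornering_vcomp free_cornering_simps cell_eqD
      cell_eq.yank_h_circ cell_eq.yank_h_bullet cell_eq.yank_v_circ cell_eq.yank_v_bullet)+

lemma mirror_boundary:
  "well_formed C t \<Longrightarrow> mirror t \<in> cells \<and> top_edge (mirror t) = term_top C t \<and>
    bottom_edge (mirror t) = term_bottom C t \<and> left_edge (mirror t) = star (term_right t) \<and>
    right_edge (mirror t) = star (term_left t)"
  by (induction t)
    (simp_all add: box_simps cell_simps star_vedge twist_simps corner_simps split: polarity.split)

text \<open>Each generating equation maps to a true one: horizontal associativity, interchange and
  the tensor of boxes go to the corresponding laws of \<open>twist\<close>, left and right units
  change places, and each yanking equation becomes that of the other polarity.\<close>

lemma mirror_cong: "cell_eq C s t \<Longrightarrow> mirror s = mirror t"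
proof (induction rule: cell_eq.induct)
  case (h_unit_left t)
  then show ?case using mirror_boundary[of t] by (simp add: twist_unit)
next
  case (h_unit_right t)
  then show ?case using mirror_boundary[of t] by (simp add: twist_unit)
next
  case (v_unit_top t)
  then show ?case using mirror_boundary[of t] FC.vcomp_unit_top[of "mirror t"] by simp
next
  case (v_unit_bottom t)
  then show ?case using mirror_boundary[of t] FC.vcomp_unit_bottom[of "mirror t"] by simp
next
  case (vid_mult x y)
  then show ?case
    using FC.VEdge_id_mult[of "star x" "star y"] star_vedge by (simp add: edge_monoid_simps)
next
  case unit_ids
  then show ?case using FC.unit_ids_coincide by (simp add: edge_monoid_simps)
qed (simp_all add: mirror_boundary twist_assoc twist_hid twist_interchange twist_box FC.vcomp_assoc
    twist_unit_boundary corner_simps corner_yanking box_Comp box_Ident)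

section \<open>Reflection of cells and its involutivity\<close>

definition reflect where "reflect c = mirror (cell_rep c)"

text \<open>The chosen representative is congruent to \<open>t\<close>, and \<open>mirror\<close> is
  constant on congruence classes.\<close>

lemma reflect_cell_class: "well_formed C t \<Longrightarrow> reflect (cell_class C t) = mirror t"
  unfolding reflect_def using mirror_cong[OF cell_eq_rep] by simp

lemma cellE:
  assumes "\<alpha> \<in> cells"
  obtains t where "well_formed C t" "\<alpha> = cell_class C t"
  using assms by (auto simp: free_cornering_simps)

lemma reflect_boundary:
  assumes "\<alpha> \<in> cells"
  shows "reflect \<alpha> \<in> cells" "top_edge (reflect \<alpha>) = top_edge \<alpha>" "bottom_edge (reflect \<alpha>) = bottom_edge \<alpha>"
    "left_edge (reflect \<alpha>) = star (right_edge \<alpha>)" "right_edge (reflect \<alpha>) = star (left_edge \<alpha>)"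
  using assms
  by (auto elim!: cellE simp: reflect_cell_class mirror_boundary free_cornering_boundary)

lemma reflect_hcomp:
  assumes "\<alpha> \<in> cells" "\<beta> \<in> cells" "right_edge \<alpha> = left_edge \<beta>"
  shows "reflect (\<alpha> \<parallel> \<beta>) = twist (reflect \<alpha>) (reflect \<beta>)"
  using assms
  by (auto elim!: cellE simp: reflect_cell_class free_cornering_hcomp free_cornering_boundary)

lemma reflect_vcomp:
  assumes "\<alpha> \<in> cells" "\<beta> \<in> cells" "bottom_edge \<alpha> = top_edge \<beta>"
  shows "reflect (\<alpha> \<then> \<beta>) = (reflect \<alpha> \<then> reflect \<beta>)"
  using assms
  by (auto elim!: cellE simp: reflect_cell_class free_cornering_vcomp free_cornering_boundary)

lemma reflect_box: "f \<in> Arr C \<Longrightarrow> reflect (box f) = box f"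
  by (simp add: box_def reflect_cell_class[of "Box f"])

lemma reflect_vid: "x \<in> lists (Ob C \<times> UNIV) \<Longrightarrow> reflect (vid x) = vid (star x)"
  by (simp add: free_cornering_simps reflect_cell_class)

text \<open>Boxes are fixed, so the outer symmetries survive, while reflecting the inner composite
  swaps it back and adds a second pair of symmetries. The two pairs are mutually inverse.\<close>

lemma reflect_twist:
  assumes "\<alpha> \<in> cells" "\<beta> \<in> cells" "left_edge \<alpha> = right_edge \<beta>"
  shows "reflect (twist \<alpha> \<beta>) = reflect \<alpha> \<parallel> reflect \<beta>"
proof -
  note [simp] = assms cell_simps arrow_simps box_simps reflect_boundary
  have "reflect (twist \<alpha> \<beta>) = box_conj (Sym C (top_edge \<alpha>) (top_edge \<beta>))
      (twist (reflect \<beta>) (reflect \<alpha>)) (Sym C (bottom_edge \<beta>) (bottom_edge \<alpha>))"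
    by (simp add: twist_def[of \<alpha>] box_conj_def reflect_vcomp reflect_hcomp reflect_box)
  then show ?thesis
    by (simp add: twist_def box_conj_box_conj Sym_involutive box_conj_Ident)
qed

text \<open>Induction on the term that represents a cell: horizontal composites come back by
  \<open>reflect_twist\<close>, vertical ones are preserved at both stages, and on generators
  polarities are flipped twice.\<close>

lemma reflect_mirror: "well_formed C t \<Longrightarrow> reflect (mirror t) = cell_class C t"
proof (induction t)
  case (HId a)
  then show ?case by (simp add: free_cornering_simps reflect_cell_class)
next
  case (VId x)
  then show ?case using star_vedge[of x]
    by (simp add: reflect_vid star_star del: map_map) (simp add: free_cornering_simps)
qed (simp_all add: reflect_cell_class flip_flip reflect_box box_def[symmetric] mirror_boundary
    reflect_twist reflect_vcomp free_cornering_hcomp free_cornering_vcomp)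

lemma reflect_reflect: "\<alpha> \<in> cells \<Longrightarrow> reflect (reflect \<alpha>) = \<alpha>"
  by (auto elim!: cellE simp: reflect_cell_class reflect_mirror)

section \<open>The contravariant involution on horizontal cells\<close>

lemma category_opposite: "category D \<Longrightarrow> category (opposite D)"
  unfolding category_def opposite_def by simp

lemma contravariant_involution_reflect:
  "contravariant_involution (horizontal_cells (free_cornering C)) star reflect"
proof -
  let ?H = "horizontal_cells (free_cornering C)"
  have cat: "category ?H"
    using FC.horizontal_cells_strict_monoidal by (rule strict_monoidal_category.axioms(1))
  \<comment> \<open>All top and bottom boundaries are units here, so the twist of two reflected
    cells is their plain horizontal composite in reverse order, as contravariance requires.\<close>
  have "category_functor (opposite ?H) ?H star reflect"
  proof (intro category_functor.intro category_opposite cat category_functor_axioms.intro)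
  qed (auto simp: opposite_def horizontal_cells_def edge_monoid_simps reflect_boundary
      reflect_hcomp twist_unit_boundary reflect_vid)
  then show ?thesis
    by (auto simp: contravariant_involution_def horizontal_cells_def reflect_reflect
        star_star simp del: map_map)
qed

end

theorem lemma6p6:
  fixes A :: "('o, 'a) symmetric_monoidal_data"
  assumes "symmetric_strict_monoidal_category A"
  shows "let H = horizontal_cells (free_cornering A) in
    \<exists>So Sa. contravariant_involution H So Sa \<and>
      So (TUnit H) = TUnit H \<and>
      (\<forall>a\<in>Ob A. So [(a, Circ)] = [(a, Bullet)] \<and> So [(a, Bullet)] = [(a, Circ)]) \<and>
      (\<forall>X\<in>Ob H. \<forall>Y\<in>Ob H. So (TOb H X Y) = TOb H (So X) (So Y)) \<and>
      (\<forall>f\<in>Arr H. \<forall>g\<in>Arr H. Sa (TArr H f g) = TArr H (Sa f) (Sa g))"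
proof -
  interpret symmetric_strict_monoidal_category A by (rule assms)
  show ?thesis
    unfolding Let_def
    \<comment> \<open>The tensor product of horizontal cells is vertical composition, which
      \<open>reflect\<close> preserves in order; on objects it is concatenation, over which
      \<open>star\<close> distributes as a map.\<close>
    by (intro exI[of _ star] exI[of _ reflect] conjI contravariant_involution_reflect)
      (auto simp: horizontal_cells_def edge_monoid_simps reflect_vcomp)
qed

end
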